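(* Let $s\ge 1$ and $t\ge 4$ be fixed integers. Then, for all sufficiently large $n$, $$\mathrm{ex}(n,\{F_{\mathcal{P},t},M_{s+1}^3\})=\begin{cases} s\binom{n-s}{2}+O(n), & \text{if } s\le t-2,\\ s\cdot t(n-s,t-1)+O(n), & \text{if } s\ge t-1,\end{cases}$$ where the implied constants in $O(n)$ may depend on $s$ and $t$ but not on $n$.
   Context: A $3$-graph is a $3$-uniform hypergraph. For a family $\mathcal{F}$ of $3$-graphs, $\mathrm{ex}(n,\mathcal{F})$ is the maximum number of edges in a $3$-graph on $n$ vertices that contains no member of $\mathcal{F}$ as a (not necessarily induced) subgraph. $M_{s+1}^3$ is the $3$-graph consisting of $s+1$ pairwise disjoint edges. For $t\ge 3$, the $3$-graph $F_{\mathcal{P},t}$ has vertex set $A\cup[t]$, where $A=\{a_1,\dots,a_{t-1}\}$ is a set of $t-1$ distinct vertices disjoint from $[t]=\{1,\dots,t\}$, and edge set $$E(F_{\mathcal{P},t})=\{\{a_i,i,j\}: 1\le i\le t-1,\ i<j\le t\}.$$ $t(n,k)$ denotes the number of edges of the Turán graph $T(n,k)$, i.e. the complete $k$-partite graph on $n$ vertices whose part sizes differ by at most $1$. (The parameter $t$ and the function $t(\cdot,\cdot)$ are different objects.) *)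

theory Defs
  imports Complex_Main "HOL-Library.Landau_Symbols"
begin

type_synonym 'a hypergraph = "'a set \<times> 'a set set"

abbreviation verts :: "'a hypergraph \<Rightarrow> 'a set" where "verts H \<equiv> fst H"

abbreviation hedges :: "'a hypergraph \<Rightarrow> 'a set set" where "hedges H \<equiv> snd H"

definition uniform :: "nat \<Rightarrow> 'a hypergraph \<Rightarrow> bool" where
  "uniform r H \<longleftrightarrow> finite (verts H) \<and> (\<forall>e\<in>hedges H. e \<subseteq> verts H \<and> card e = r)"

text \<open>A copy of \<open>F\<close> in \<open>H\<close>, as a not necessarily induced subgraph.\<close>

definition contains_copy :: "'a hypergraph \<Rightarrow> 'b hypergraph \<Rightarrow> bool" where
  "contains_copy H F \<longleftrightarrow>
     (\<exists>f. inj_on f (verts F) \<and> f ` verts F \<subseteq> verts H \<and> (\<forall>e\<in>hedges F. f ` e \<in> hedges H))"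

text \<open>Vertices are natural numbers, which is no restriction for finite hypergraphs.
  The maximum is over a finite set; it is meaningful when this set is nonempty, e.g. when every
  member of the family has an edge.\<close>

definition ex3 :: "nat \<Rightarrow> nat hypergraph set \<Rightarrow> nat" where
  "ex3 n \<F> = Max {card (hedges H) | H :: nat hypergraph.
     uniform 3 H \<and> card (verts H) = n \<and> (\<forall>F\<in>\<F>. \<not> contains_copy H F)}"

definition matching3 :: "nat \<Rightarrow> nat hypergraph" where
  "matching3 k = ({..<3 * k}, {{3 * i, 3 * i + 1, 3 * i + 2} | i. i < k})"

text \<open>\<open>F_P t\<close> lives on \<open>{1..t}\<close> together with the vertices \<open>a_i\<close>, for which we take
  \<open>t + i\<close> (\<open>1 \<le> i \<le> t - 1\<close>).\<close>

definition F_P :: "nat \<Rightarrow> nat hypergraph" where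
  "F_P t = ((\<lambda>i. t + i) ` {1..t - 1} \<union> {1..t},
            {{t + i, i, j} | i j. 1 \<le> i \<and> i \<le> t - 1 \<and> i < j \<and> j \<le> t})"

text \<open>The parts of the Turan graph are the residue classes modulo \<open>k\<close>; by
  \<open>turan_part_card\<close> below, their sizes differ by at most one.\<close>

definition turan_part :: "nat \<Rightarrow> nat \<Rightarrow> nat \<Rightarrow> nat set" where
  "turan_part n k i = {v. v < n \<and> v mod k = i}"

definition turan_graph :: "nat \<Rightarrow> nat \<Rightarrow> nat hypergraph" where
  "turan_graph n k = ({..<n},
     {{u, v} | u v i j. i < k \<and> j < k \<and> i \<noteq> j \<and> u \<in> turan_part n k i \<and> v \<in> turan_part n k j})"

definition turan_num :: "nat \<Rightarrow> nat \<Rightarrow> nat" where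
  "turan_num n k = card (hedges (turan_graph n k))"

lemma turan_part_card:
  assumes "i < k"
  shows "card (turan_part n k i) = n div k + (if i < n mod k then 1 else 0)"
proof (induction n)
  case 0
  show ?case by (simp add: turan_part_def)
next
  case (Suc n)
  have "turan_part (Suc n) k i
      = (if n mod k = i then insert n (turan_part n k i) else turan_part n k i)"
    by (auto simp: turan_part_def less_Suc_eq)
  moreover have "finite (turan_part n k i)" "n \<notin> turan_part n k i"
    by (auto simp: turan_part_def)
  ultimately show ?case
    using Suc assms by (auto simp: div_Suc mod_Suc)
qed

end

theory Submission
  imports Defs
begin

text \<open>Lower bounds: join \<open>s\<close> apex vertices to the complete graph, respectively the Turan graph, on the
  other \<open>n - s\<close> vertices.

  Upper bounds: at most \<open>s\<close> vertices can have degree above \<open>4 * s * n\<close>, since \<open>s + 1\<close> of them could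
  be matched greedily. So some \<open>s\<close>-set \<open>S\<close> contains all of them, and then all but \<open>O(n)\<close> edges meet
  \<open>S\<close> in exactly one vertex. This leaves the \<open>s\<close> link graphs of \<open>S\<close> on the other vertices. For
  \<open>s \<le> t - 2\<close> the trivial bound on each link suffices. For \<open>s \<ge> t - 1 = k\<close>, grow a sequence of
  vertices in which each new vertex misses fewer than \<open>s * r / k\<close> of the \<open>s * r\<close> possible link edges
  to its \<open>r\<close> predecessors. If it reaches \<open>k + 1\<close> vertices, distinct links can be chosen for them one
  after the other, starting from the last vertex, which gives a copy of \<open>F_P t\<close>. If it gets stuck at
  \<open>r\<close> vertices, these send little to the outside and are deleted, as in the classical inductive proof
  of Turan's theorem; the loss is linear in \<open>n\<close>.\<close>

section \<open>Graphs indexed by a set of labels\<close>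

text \<open>Labels are chosen greedily for \<open>j = Suc l, ..., 1\<close>. Put
  \<open>k = Suc l\<close> and \<open>s = card S\<close>. By \<open>dense\<close>, fewer than
  \<open>s * j / k\<close> labels miss some predecessor of \<open>x j\<close>. The
  \<open>k - j\<close> labels already taken number at most \<open>s * (k - j) / k\<close>, since
  \<open>k \<le> s\<close>. Together these are fewer than \<open>s\<close>, so a label is left. The
  downward order balances the two: a large \<open>j\<close> allows many unusable labels but meets
  few used ones.\<close>

lemma rainbow_labels:
  fixes x :: "nat \<Rightarrow> 'v" and adj :: "'a \<Rightarrow> 'v \<Rightarrow> 'v \<Rightarrow> bool"
  assumes "finite S" and "Suc l \<le> card S"
    and dense: "\<And>j. \<lbrakk>1 \<le> j; j \<le> Suc l\<rbrakk> \<Longrightarrow>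
      card S * l * j < Suc l * (\<Sum>i<j. card {a \<in> S. adj a (x j) (x i)})"
  shows "\<exists>b. inj_on b {1..Suc l} \<and> b ` {1..Suc l} \<subseteq> S \<and>
    (\<forall>j\<in>{1..Suc l}. \<forall>i<j. adj (b j) (x j) (x i))"
proof -
  \<comment> \<open>\<open>d\<close> counts the vertices labelled so far, namely the last
    \<open>d\<close> of the sequence.\<close>
  have "\<exists>b. inj_on b {Suc l - d<..Suc l} \<and> b ` {Suc l - d<..Suc l} \<subseteq> S \<and>
    (\<forall>j\<in>{Suc l - d<..Suc l}. \<forall>i<j. adj (b j) (x j) (x i))" if "d \<le> Suc l" for d
    using that
  proof (induction d)
    case 0
    then show ?case by simp
  next
    case (Suc d)
    then obtain b where b: "inj_on b {Suc l - d<..Suc l}" "b ` {Suc l - d<..Suc l} \<subseteq> S"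
      "\<And>j i. \<lbrakk>j\<in>{Suc l - d<..Suc l}; i<j\<rbrakk> \<Longrightarrow> adj (b j) (x j) (x i)"
      by auto
    define j where "j = Suc l - d"
    have j: "1 \<le> j" "j \<le> Suc l" "d = Suc l - j" using Suc.prems by (auto simp: j_def)
    have J: "{Suc l - Suc d<..Suc l} = insert j {j<..Suc l}"
      using j(1,2) Suc.prems unfolding j_def by (simp add: set_eq_iff) arith
    define bad where "bad = (\<Union>i<j. {a \<in> S. \<not> adj a (x j) (x i)})"
    define used where "used = b ` {j<..Suc l}"
    have split: "card {a \<in> S. adj a (x j) (x i)} + card {a \<in> S. \<not> adj a (x j) (x i)} = card S" for i
    proof -
      have "card S = card ({a \<in> S. adj a (x j) (x i)} \<union> {a \<in> S. \<not> adj a (x j) (x i)})"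
        by (rule arg_cong[of _ _ card]) auto
      also have "\<dots> = card {a \<in> S. adj a (x j) (x i)} + card {a \<in> S. \<not> adj a (x j) (x i)}"
        using \<open>finite S\<close> by (intro card_Un_disjoint) auto
      finally show ?thesis by simp
    qed
    have "card bad \<le> (\<Sum>i<j. card {a \<in> S. \<not> adj a (x j) (x i)})"
      unfolding bad_def by (rule card_UN_le) simp
    then have "card bad + (\<Sum>i<j. card {a \<in> S. adj a (x j) (x i)})
      \<le> (\<Sum>i<j. card {a \<in> S. adj a (x j) (x i)} + card {a \<in> S. \<not> adj a (x j) (x i)})"
      by (simp add: sum.distrib)
    then have "card bad + (\<Sum>i<j. card {a \<in> S. adj a (x j) (x i)}) \<le> card S * j"
      by (simp add: split mult.commute)
    then have "Suc l * card bad + Suc l * (\<Sum>i<j. card {a \<in> S. adj a (x j) (x i)}) \<le> Suc l * (card S * j)"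
      by (metis add_mult_distrib2 mult_le_mono2)
    with dense[OF j(1,2)] have 1: "Suc l * card bad < card S * j"
      by (simp add: algebra_simps)
    have "card used \<le> Suc l - j"
      unfolding used_def using card_image_le[of "{j<..Suc l}" b] by simp
    then have "Suc l * card used \<le> Suc l * (Suc l - j)" by (rule mult_le_mono2)
    \<comment> \<open>With \<open>Suc l = j + q\<close> this reduces to
      \<open>q * Suc l \<le> q * card S\<close>; here the assumption that there are at least
      \<open>Suc l\<close> labels enters.\<close>
    moreover have "card S * j + Suc l * (Suc l - j) \<le> Suc l * card S"
    proof -
      obtain q where q: "Suc l = j + q" using j(2) le_Suc_ex by blast
      have "q * Suc l \<le> q * card S" using assms(2) by (rule mult_le_mono2)
      then show ?thesis unfolding q by (simp add: algebra_simps)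
    qed
    ultimately have "Suc l * (card bad + card used) < Suc l * card S"
      using 1 by (simp add: algebra_simps)
    then have "card bad + card used < card S" 
      unfolding mult_less_cancel1 by (rule conjunct2)
    then have "card (bad \<union> used) < card S" using card_Un_le[of bad used] by linarith
    moreover have "finite (bad \<union> used)"
      unfolding bad_def used_def using \<open>finite S\<close> by auto
    ultimately have "\<not> S \<subseteq> bad \<union> used"
      using card_mono[of "bad \<union> used" S] by linarith
    then obtain a where a: "a \<in> S" "a \<notin> bad" "a \<notin> used" by auto
    have "inj_on (b(j := a)) (insert j {j<..Suc l})"
    proof (rule inj_on_insert[THEN iffD2], intro conjI)
      show "inj_on (b(j := a)) {j<..Suc l}"
        using b(1) a(3) unfolding used_def j_def[symmetric] by (rule inj_on_fun_updI)
      show "(b(j := a)) j \<notin> (b(j := a)) ` ({j<..Suc l} - {j})"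
        using a(3) unfolding used_def by auto
    qed
    moreover have "(b(j := a)) ` insert j {j<..Suc l} \<subseteq> S"
      using b(2) a(1) unfolding j_def[symmetric] by (force simp: image_subset_iff)
    moreover have "adj ((b(j := a)) j') (x j') (x i)"
      if "j' \<in> insert j {j<..Suc l}" "i < j'" for j' i
    proof (cases "j' = j")
      case True
      then show ?thesis using a(1,2) that(2) unfolding bad_def by auto
    next
      case False
      then have "j' \<in> {Suc l - d<..Suc l}" using that(1) by (simp add: j_def)
      from b(3)[OF this that(2)] False show ?thesis by simp
    qed
    ultimately show ?case unfolding J by blast
  qed
  from this[of "Suc l"] show ?thesis
    by (simp add: atLeastSucAtMost_greaterThanAtMost)
qed

text \<open>Greedy growth from an arbitrary first vertex, with \<open>c / d\<close> as density
  threshold. The extension condition speaks of sets rather than sequences, so that its failure hands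
  over a set \<open>T\<close> to be deleted in the next proof.\<close>

lemma dense_chain:
  fixes m :: "'v \<Rightarrow> 'v \<Rightarrow> nat"
  assumes "V \<noteq> {}"
    and ext: "\<And>T. \<lbrakk>T \<subseteq> V; T \<noteq> {}; card T \<le> k\<rbrakk> \<Longrightarrow> \<exists>v\<in>V - T. c * card T < d * (\<Sum>u\<in>T. m v u)"
  shows "\<exists>x. inj_on x {..k} \<and> x ` {..k} \<subseteq> V \<and>
    (\<forall>j\<in>{1..k}. c * j < d * (\<Sum>i<j. m (x j) (x i)))"
proof -
  have "\<exists>x. inj_on x {..r} \<and> x ` {..r} \<subseteq> V \<and>
    (\<forall>j\<in>{1..r}. c * j < d * (\<Sum>i<j. m (x j) (x i)))" if "r \<le> k" for r
    using that
  proof (induction r)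
    case 0
    obtain v where "v \<in> V" using assms(1) by auto
    then show ?case by (intro exI[of _ "\<lambda>_. v"]) auto
  next
    case (Suc r)
    then obtain x where x: "inj_on x {..r}" "x ` {..r} \<subseteq> V"
      "\<And>j. j\<in>{1..r} \<Longrightarrow> c * j < d * (\<Sum>i<j. m (x j) (x i))"
      by auto
    have cT: "card (x ` {..r}) = Suc r" using x(1) by (simp add: card_image)
    then obtain v where v: "v \<in> V - x ` {..r}" "c * Suc r < d * (\<Sum>u\<in>x ` {..r}. m v u)"
      using ext[of "x ` {..r}"] x(2) Suc.prems by auto
    have v2: "c * Suc r < d * (\<Sum>i<Suc r. m v (x i))"
      using v(2) x(1) by (simp add: sum.reindex lessThan_Suc_atMost)
    have "inj_on (x(Suc r := v)) {..Suc r}"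
      using x(1) v(1) by (auto simp: inj_on_def le_Suc_eq)
    moreover have "(x(Suc r := v)) ` {..Suc r} \<subseteq> V"
      using x(2) v(1) by (auto simp: le_Suc_eq)
    moreover have "c * j < d * (\<Sum>i<j. m ((x(Suc r := v)) j) ((x(Suc r := v)) i))"
      if "j \<in> {1..Suc r}" for j
    proof (cases "j = Suc r")
      case True
      then show ?thesis using v2 by simp
    next
      case False
      then have "j \<in> {1..r}" using that by auto
      moreover from this have "(\<Sum>i<j. m ((x(Suc r := v)) j) ((x(Suc r := v)) i)) = (\<Sum>i<j. m (x j) (x i))"
        by (intro sum.cong) auto
      ultimately show ?thesis using x(3)[of j] by simp
    qed
    ultimately show ?case by blast
  qed
  then show ?thesis by blast
qed

text \<open>This is \<open>card S\<close> times the Turan bound, up to a linear term, cleared of the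
  denominator \<open>Suc l\<close> and counted over ordered pairs. The induction is strong because
  the size of the deleted set \<open>T\<close> varies. The pairs within the rest \<open>U\<close>,
  across (twice), and within \<open>T\<close> match the terms of
  \<open>(|U| + |T|)^2\<close>.\<close>

lemma rainbow_clique_bound:
  fixes adj :: "'a \<Rightarrow> 'v \<Rightarrow> 'v \<Rightarrow> bool"
  assumes "finite S" and "Suc l \<le> card S" and "finite V"
    and sym: "\<And>a u v. adj a u v \<Longrightarrow> adj a v u"
    and free: "\<nexists>x b. inj_on x {..Suc l} \<and> x ` {..Suc l} \<subseteq> V \<and>
      inj_on b {1..Suc l} \<and> b ` {1..Suc l} \<subseteq> S \<and>
      (\<forall>j\<in>{1..Suc l}. \<forall>i<j. adj (b j) (x j) (x i))"
  shows "Suc l * (\<Sum>u\<in>V. \<Sum>v\<in>V. card {a \<in> S. adj a u v})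
    \<le> card S * l * (card V)\<^sup>2 + card S * Suc l * card V"
  using \<open>finite V\<close> free
proof (induction "card V" arbitrary: V rule: less_induct)
  case less
  define m where "m u v = card {a \<in> S. adj a u v}" for u v
  have msym: "m u v = m v u" for u v
    unfolding m_def using sym by (intro arg_cong[of _ _ card]) auto
  have mle: "m u v \<le> card S" for u v
    unfolding m_def using \<open>finite S\<close> by (intro card_mono) auto
  show ?case
  proof (cases "V = {}")
    case True
    then show ?thesis by simp
  next
    case False
    \<comment> \<open>Were there no such \<open>T\<close>, \<open>dense_chain\<close> would give
      \<open>Suc l + 1\<close> vertices and \<open>rainbow_labels\<close> distinct labels for all
      but the first of them: the forbidden configuration.\<close>
    have "\<exists>T. T \<subseteq> V \<and> T \<noteq> {} \<and> card T \<le> Suc l \<and>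
      (\<forall>v\<in>V - T. Suc l * (\<Sum>u\<in>T. m v u) \<le> card S * l * card T)"
    proof (rule ccontr)
      assume "\<not> ?thesis"
      then have "\<exists>v\<in>V - T. card S * l * card T < Suc l * (\<Sum>u\<in>T. m v u)"
        if "T \<subseteq> V" "T \<noteq> {}" "card T \<le> Suc l" for T
        using that by (meson not_le)
      from dense_chain[of V "Suc l" "card S * l" "Suc l" m, OF False this]
      obtain x where x: "inj_on x {..Suc l}" "x ` {..Suc l} \<subseteq> V"
        "\<And>j. j\<in>{1..Suc l} \<Longrightarrow> card S * l * j < Suc l * (\<Sum>i<j. m (x j) (x i))"
        by blast
      obtain b where "inj_on b {1..Suc l}" "b ` {1..Suc l} \<subseteq> S"
        "\<forall>j\<in>{1..Suc l}. \<forall>i<j. adj (b j) (x j) (x i)"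
        using rainbow_labels[OF assms(1,2), of adj x] x(3) unfolding m_def by auto
      then show False using less.prems(2) x(1,2) by blast
    qed
    then obtain T where T: "T \<subseteq> V" "T \<noteq> {}" "card T \<le> Suc l"
      "\<And>v. v\<in>V - T \<Longrightarrow> Suc l * (\<Sum>u\<in>T. m v u) \<le> card S * l * card T"
      by blast
    define U where "U = V - T"
    have fin: "finite T" "finite U" "U \<inter> T = {}" "V = U \<union> T"
      using T(1) less.prems(1) finite_subset by (auto simp: U_def)
    have card: "card V = card U + card T" using fin by (simp add: card_Un_disjoint)
    have "0 < card T" using T(2) fin by auto
    have "\<nexists>x b. inj_on x {..Suc l} \<and> x ` {..Suc l} \<subseteq> U \<and>
      inj_on b {1..Suc l} \<and> b ` {1..Suc l} \<subseteq> S \<and>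
      (\<forall>j\<in>{1..Suc l}. \<forall>i<j. adj (b j) (x j) (x i))"
    proof (intro notI, elim exE conjE)
      fix x b
      assume xb: "inj_on x {..Suc l}" "x ` {..Suc l} \<subseteq> U" "inj_on b {1..Suc l}"
        "b ` {1..Suc l} \<subseteq> S" "\<forall>j\<in>{1..Suc l}. \<forall>i<j. adj (b j) (x j) (x i)"
      have "x ` {..Suc l} \<subseteq> V" using xb(2) unfolding U_def by blast
      with xb less.prems(2)[unfolded not_ex, rule_format, of x b] show False
        by (elim notE) (intro conjI; assumption)
    qed
    then have IH: "Suc l * (\<Sum>u\<in>U. \<Sum>v\<in>U. m u v)
      \<le> card S * l * (card U)\<^sup>2 + card S * Suc l * card U"
      unfolding m_def using card \<open>0 < card T\<close> fin(2) by (intro less.hyps) simp_all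
    have "Suc l * (\<Sum>u\<in>U. \<Sum>v\<in>T. m u v) = (\<Sum>u\<in>U. Suc l * (\<Sum>v\<in>T. m u v))"
      by (rule sum_distrib_left)
    also have "\<dots> \<le> (\<Sum>u\<in>U. card S * l * card T)"
      using T(4) by (intro sum_mono) (simp add: U_def)
    also have "\<dots> = card S * l * card T * card U" by simp
    finally have cross: "Suc l * (\<Sum>u\<in>U. \<Sum>v\<in>T. m u v) \<le> card S * l * card T * card U" .
    \<comment> \<open>Inside \<open>T\<close> only the trivial bound \<open>card S\<close> per pair
      is used. Since \<open>Suc l * |T|^2 = l * |T|^2 + |T|^2\<close> and
      \<open>card T \<le> Suc l\<close>, the excess is at most
      \<open>card S * Suc l * card T\<close>; this is the source of the linear term.\<close>
    have "(\<Sum>u\<in>T. \<Sum>v\<in>T. m u v) \<le> (\<Sum>u\<in>T. \<Sum>v\<in>T. card S)"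
      using mle by (intro sum_mono)
    then have "(\<Sum>u\<in>T. \<Sum>v\<in>T. m u v) \<le> card S * card T * card T"
      by (simp add: ac_simps)
    then have "Suc l * (\<Sum>u\<in>T. \<Sum>v\<in>T. m u v) \<le> Suc l * (card S * card T * card T)"
      by (rule mult_le_mono2)
    moreover have "card T * (card S * card T) \<le> Suc l * (card S * card T)"
      using T(3) by (rule mult_le_mono1)
    ultimately have TT: "Suc l * (\<Sum>u\<in>T. \<Sum>v\<in>T. m u v)
      \<le> card S * l * (card T)\<^sup>2 + card S * Suc l * card T"
      by (simp add: power2_eq_square algebra_simps)
    have "(\<Sum>u\<in>V. \<Sum>v\<in>V. m u v) = (\<Sum>u\<in>U. \<Sum>v\<in>U. m u v) + (\<Sum>u\<in>U. \<Sum>v\<in>T. m u v)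
      + ((\<Sum>u\<in>T. \<Sum>v\<in>U. m u v) + (\<Sum>u\<in>T. \<Sum>v\<in>T. m u v))"
      using fin by (simp add: sum.union_disjoint sum.distrib)
    also have "(\<Sum>u\<in>T. \<Sum>v\<in>U. m u v) = (\<Sum>u\<in>U. \<Sum>v\<in>T. m u v)"
      by (subst sum.swap) (simp add: msym)
    finally have "Suc l * (\<Sum>u\<in>V. \<Sum>v\<in>V. m u v) = Suc l * (\<Sum>u\<in>U. \<Sum>v\<in>U. m u v)
      + 2 * (Suc l * (\<Sum>u\<in>U. \<Sum>v\<in>T. m u v)) + Suc l * (\<Sum>u\<in>T. \<Sum>v\<in>T. m u v)"
      by (simp only: algebra_simps mult_2 mult_2_right)
    also have "\<dots> \<le> (card S * l * (card U)\<^sup>2 + card S * Suc l * card U)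
      + 2 * (card S * l * card T * card U)
      + (card S * l * (card T)\<^sup>2 + card S * Suc l * card T)"
      using IH cross TT by linarith
    also have "\<dots> = card S * l * (card V)\<^sup>2 + card S * Suc l * card V"
      unfolding card by (simp add: power2_eq_square algebra_simps)
    finally show ?thesis unfolding m_def .
  qed
qed

section \<open>Turan graphs\<close>

lemma card_ordered_pairs:
  assumes "finite P" and "\<And>p. p \<in> P \<Longrightarrow> card p = 2"
  shows "card {(u, v). {u, v} \<in> P} = 2 * card P"
proof -
  have pair: "card {(u, v). {u, v} = p} = 2 \<and> finite {(u, v). {u, v} = p}" if "p \<in> P" for p
  proof -
    obtain x y where "p = {x, y}" "x \<noteq> y" using assms(2)[OF \<open>p \<in> P\<close>] card_2_iff by metis
    then have "{(u, v). {u, v} = p} = {(x, y), (y, x)}" by (auto simp: doubleton_eq_iff)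
    then show ?thesis using \<open>x \<noteq> y\<close> by simp
  qed
  have "card {(u, v). {u, v} \<in> P} = card (\<Union>p\<in>P. {(u, v). {u, v} = p})"
    by (rule arg_cong[of _ _ card]) auto
  also have "\<dots> = (\<Sum>p\<in>P. card {(u, v). {u, v} = p})"
    using pair assms(1) by (intro card_UN_disjoint) auto
  also have "\<dots> = 2 * card P" using pair by simp
  finally show ?thesis .
qed

lemma hedges_turan_graph:
  assumes "k > 0"
  shows "hedges (turan_graph n k) = {{u, v} | u v. u < n \<and> v < n \<and> u mod k \<noteq> v mod k}"
  using assms unfolding turan_graph_def turan_part_def by fastforce

lemma finite_turan_graph: "finite (hedges (turan_graph n k))"
proof (rule finite_subset)
  show "hedges (turan_graph n k) \<subseteq> Pow {..<n}"
    by (auto simp: turan_graph_def turan_part_def)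
qed simp

text \<open>An ordered pair of vertices either forms an edge, each edge being met twice, or lies in
  a common residue class, and a class has at most \<open>n div k + 1\<close> elements. Clearing
  denominators avoids rounding; what is expressed is
  \<open>(1 - 1/k) * n^2 / 2 \<le> t(n, k) + n / 2\<close>, which later turns the quadratic upper
  bound into a Turan number.\<close>

lemma turan_num_ge:
  assumes "k > 0"
  shows "k * n\<^sup>2 \<le> 2 * k * turan_num n k + n\<^sup>2 + k * n"
proof -
  let ?E = "hedges (turan_graph n k)"
  let ?Q = "SIGMA u:{..<n}. turan_part n k (u mod k)"
  have E: "?E = {{u, v} | u v. u < n \<and> v < n \<and> u mod k \<noteq> v mod k}"
    using assms by (rule hedges_turan_graph)
  have two: "card p = 2" if "p \<in> ?E" for p
    using that unfolding E by (auto simp: card_insert_if)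
  have "{..<n} \<times> {..<n} \<subseteq> {(u, v). {u, v} \<in> ?E} \<union> ?Q"
    unfolding E by (auto simp: turan_part_def)
  moreover have finQ: "finite ?Q" by (auto simp: turan_part_def)
  moreover have finE: "finite {(u, v). {u, v} \<in> ?E}"
    by (rule finite_subset[of _ "{..<n} \<times> {..<n}"]) (auto simp: turan_graph_def turan_part_def doubleton_eq_iff)
  ultimately have "card ({..<n} \<times> {..<n}) \<le> card ({(u, v). {u, v} \<in> ?E} \<union> ?Q)"
    by (intro card_mono) auto
  also have "\<dots> \<le> card {(u, v). {u, v} \<in> ?E} + card ?Q" by (rule card_Un_le)
  also have "card {(u, v). {u, v} \<in> ?E} = 2 * turan_num n k"
    unfolding turan_num_def by (rule card_ordered_pairs[OF finite_turan_graph two])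
  also have "card ?Q = (\<Sum>u<n. card (turan_part n k (u mod k)))"
    by (simp add: turan_part_def)
  also have "\<dots> \<le> (\<Sum>u<n. n div k + 1)"
    using assms by (intro sum_mono) (simp add: turan_part_card)
  finally have "n\<^sup>2 \<le> 2 * turan_num n k + n * (n div k + 1)"
    by (simp add: power2_eq_square)
  then have "k * n\<^sup>2 \<le> k * (2 * turan_num n k + n * (n div k + 1))" by (rule mult_le_mono2)
  also have "\<dots> = 2 * k * turan_num n k + n * (k * (n div k)) + k * n" by (simp add: algebra_simps)
  also have "\<dots> \<le> 2 * k * turan_num n k + n * n + k * n"
    using times_div_less_eq_dividend[of k n] by (intro add_mono mult_le_mono2) auto
  finally show ?thesis by (simp add: power2_eq_square)
qed

section \<open>Hypergraphs with bounded matching number\<close>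

lemma card_edges_Int_le:
  assumes "uniform 3 (V, E)" and "u \<noteq> v"
  shows "card {e \<in> E. u \<in> e \<and> v \<in> e} \<le> card V"
proof -
  have "{e \<in> E. u \<in> e \<and> v \<in> e} \<subseteq> (\<lambda>x. {u, v, x}) ` V"
  proof
    fix e
    assume e: "e \<in> {e \<in> E. u \<in> e \<and> v \<in> e}"
    then have "card e = 3" "e \<subseteq> V" using assms(1) by (auto simp: uniform_def)
    moreover have "card (e - {u, v}) = card e - card {u, v}"
      using e by (intro card_Diff_subset) auto
    ultimately have "card (e - {u, v}) = 1" using assms(2) by simp
    then obtain x where "e - {u, v} = {x}" by (rule card_1_singletonE)
    then have "e = {u, v, x}" "x \<in> V" using e \<open>e \<subseteq> V\<close> by auto
    then show "e \<in> (\<lambda>x. {u, v, x}) ` V" by blast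
  qed
  then show ?thesis
    using assms(1) surj_card_le by (fastforce simp: uniform_def)
qed

lemma finite_edges: "uniform r (V, E) \<Longrightarrow> finite E"
  by (rule finite_subset[of _ "Pow V"]) (auto simp: uniform_def)

lemma card_edges_hit_le:
  assumes "uniform 3 (V, E)" and "v \<notin> W" and "finite W"
  shows "card {e \<in> E. v \<in> e \<and> e \<inter> W \<noteq> {}} \<le> card W * card V"
proof -
  have "card {e \<in> E. v \<in> e \<and> e \<inter> W \<noteq> {}} \<le> card (\<Union>w\<in>W. {e \<in> E. v \<in> e \<and> w \<in> e})"
    using finite_edges[OF assms(1)] assms(3) by (intro card_mono) auto
  also have "\<dots> \<le> (\<Sum>w\<in>W. card {e \<in> E. v \<in> e \<and> w \<in> e})"
    using assms(3) by (rule card_UN_le)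
  also have "\<dots> \<le> (\<Sum>w\<in>W. card V)"
    using assms(1,2) by (intro sum_mono card_edges_Int_le) auto
  finally show ?thesis by simp
qed

lemma contains_copy_matching3I:
  assumes "uniform 3 (V, E)" and "M \<subseteq> E" and disj: "pairwise disjnt M"
  shows "contains_copy (V, E) (matching3 (card M))"
proof -
  have "finite M" using assms(2) finite_edges[OF assms(1)] finite_subset by blast
  then obtain h where h: "bij_betw h {0..<card M} M" using ex_bij_betw_nat_finite by blast
  have hM: "h i \<in> M" if "i < card M" for i
    using h that by (auto simp: bij_betw_def)
  have "\<exists>g. bij_betw g {0..<3::nat} (h i)" if "i < card M" for i
  proof -
    have "h i \<in> E" using hM[OF that] assms(2) by blast
    then have "card (h i) = 3" "finite (h i)"
      using assms(1) finite_subset by (auto simp: uniform_def)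
    then show ?thesis using ex_bij_betw_nat_finite[of "h i"] by simp
  qed
  then obtain g where g: "\<And>i. i < card M \<Longrightarrow> bij_betw (g i) {0..<3::nat} (h i)" by metis
  \<comment> \<open>Vertex \<open>v\<close> of \<open>matching3\<close> goes to entry
    \<open>v mod 3\<close> of edge number \<open>v div 3\<close>.\<close>
  define f where "f v = g (v div 3) (v mod 3)" for v
  have fh: "f v \<in> h (v div 3)" if "v < 3 * card M" for v
  proof -
    have "v div 3 < card M" using that by auto
    then have "h (v div 3) = g (v div 3) ` {0..<3}" using g by (simp add: bij_betw_def)
    moreover have "v mod 3 \<in> {0..<3}" by simp
    ultimately show ?thesis unfolding f_def by blast
  qed
  have "inj_on f {..<3 * card M}"
  proof (rule inj_onI)
    fix u v
    assume uv: "u \<in> {..<3 * card M}" "v \<in> {..<3 * card M}" "f u = f v"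
    then have lt: "u div 3 < card M" "v div 3 < card M" by auto
    have "f u \<in> h (u div 3)" "f u \<in> h (v div 3)" using uv fh[of u] fh[of v] by auto
    then have "h (u div 3) = h (v div 3)"
      using disj hM[OF lt(1)] hM[OF lt(2)] unfolding pairwise_def disjnt_def by blast
    then have d: "u div 3 = v div 3"
      using h lt unfolding bij_betw_def inj_on_def by auto
    then have "u mod 3 = v mod 3"
      using uv(3) g[OF lt(1)] unfolding f_def bij_betw_def inj_on_def by auto
    with d show "u = v" by (metis div_mult_mod_eq)
  qed
  moreover have "f ` {..<3 * card M} \<subseteq> V"
  proof
    fix y
    assume "y \<in> f ` {..<3 * card M}"
    then obtain v where v: "v < 3 * card M" "y = f v" by auto
    then have "y \<in> h (v div 3)" "h (v div 3) \<in> E" using fh[of v] hM[of "v div 3"] assms(2) by auto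
    then show "y \<in> V" using assms(1) by (auto simp: uniform_def)
  qed
  moreover have "f ` {3 * i, 3 * i + 1, 3 * i + 2} \<in> E" if "i < card M" for i
  proof -
    have "{0..<3::nat} = {0, 1, 2}" by auto
    moreover have "(3 * i + 1) div 3 = i" "(3 * i + 2) div 3 = i" by auto
    moreover have "(3 * i + 1) mod 3 = 1" "(3 * i + 2) mod 3 = 2" by presburger+
    ultimately have "f ` {3 * i, 3 * i + 1, 3 * i + 2} = g i ` {0..<3}"
      unfolding f_def by simp
    also have "\<dots> = h i" using g[OF that] by (simp add: bij_betw_def)
    finally show ?thesis using hM[OF that] assms(2) by auto
  qed
  ultimately show ?thesis
    unfolding contains_copy_def matching3_def by (intro exI[of _ f]) auto
qed

text \<open>Each heavy vertex in turn receives an edge avoiding everything that must be kept free.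
  At most \<open>4 * s\<close> vertices must be avoided, and each of them spoils at most
  \<open>card V\<close> edges at the current vertex.\<close>

lemma matching_of_heavy_vertices:
  assumes uni: "uniform 3 (V, E)" and "finite B" and "card B \<le> Suc s"
    and heavy: "\<And>v. v \<in> B \<Longrightarrow> 4 * s * card V < card {e \<in> E. v \<in> e}"
  shows "\<exists>M\<subseteq>E. pairwise disjnt M \<and> card M = card B"
proof -
  \<comment> \<open>The clause \<open>e \<inter> B \<subseteq> A\<close> keeps the heavy vertices
    that are still to be matched off the matching built so far.\<close>
  have "\<exists>M\<subseteq>E. pairwise disjnt M \<and> card M = card A \<and> (\<forall>e\<in>M. e \<inter> B \<subseteq> A)" if "A \<subseteq> B" for A
    using finite_subset[OF that \<open>finite B\<close>] that
  proof (induction A rule: finite_induct)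
    case empty
    then show ?case by (intro exI[of _ "{}"]) auto
  next
    case (insert v A)
    then obtain M where M: "M \<subseteq> E" "pairwise disjnt M" "card M = card A" "\<And>e. e \<in> M \<Longrightarrow> e \<inter> B \<subseteq> A"
      by auto
    have "finite M" using M(1) finite_edges[OF uni] finite_subset by blast
    have e3: "card e = 3 \<and> finite e" if "e \<in> E" for e
      using uni that finite_subset by (auto simp: uniform_def)
    \<comment> \<open>At most \<open>3 * s\<close> vertices come from the edges chosen before and at
      most \<open>s\<close> from the other heavy vertices, hence the factor
      \<open>4 * s\<close>.\<close>
    define W where "W = \<Union>M \<union> (B - {v})"
    have finW: "finite W" using \<open>finite M\<close> \<open>finite B\<close> e3 M(1) unfolding W_def by auto
    have "card (insert v A) \<le> card B" using insert.prems \<open>finite B\<close> card_mono by blast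
    then have "card A \<le> s" using insert.hyps assms(3) by simp
    have "card (\<Union>M) \<le> sum card M"
      using \<open>finite M\<close> e3 M(1) by (intro card_Union_le_sum_card)
    also have "sum card M = 3 * card A" using e3 M(1,3) by (simp add: subset_iff)
    finally have "card (\<Union>M) \<le> 3 * s" using \<open>card A \<le> s\<close> by linarith
    moreover have "card (B - {v}) \<le> s"
      using insert.prems assms(2,3) by (simp add: card_Diff_singleton)
    ultimately have "card W \<le> 4 * s"
      unfolding W_def using card_Un_le[of "\<Union>M" "B - {v}"] by linarith
    moreover have "v \<notin> W"
      using M(4) insert.prems insert.hyps unfolding W_def by blast
    ultimately have "v \<notin> W" "card W * card V \<le> 4 * s * card V"
      using mult_le_mono1 by blast+
    then have "card {e \<in> E. v \<in> e \<and> e \<inter> W \<noteq> {}} \<le> 4 * s * card V"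
      using card_edges_hit_le[OF uni _ finW] order_trans by blast
    also have "\<dots> < card {e \<in> E. v \<in> e}" using heavy insert.prems by simp
    finally have less: "card {e \<in> E. v \<in> e \<and> e \<inter> W \<noteq> {}} < card {e \<in> E. v \<in> e}" .
    have "\<exists>e\<in>E. v \<in> e \<and> e \<inter> W = {}"
    proof (rule ccontr)
      assume "\<not> ?thesis"
      then have "{e \<in> E. v \<in> e \<and> e \<inter> W \<noteq> {}} = {e \<in> E. v \<in> e}" by blast
      with less show False by simp
    qed
    then obtain e where e: "e \<in> E" "v \<in> e" "e \<inter> W = {}" by blast
    have "e \<notin> M" using e \<open>v \<notin> W\<close> unfolding W_def by blast
    have "insert e M \<subseteq> E" using e M(1) by auto
    moreover have "pairwise disjnt (insert e M)"
      using M(2) e(3) unfolding pairwise_insert W_def disjnt_def by blast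
    moreover have "card (insert e M) = card (insert v A)"
      using \<open>e \<notin> M\<close> \<open>finite M\<close> M(3) insert.hyps by simp
    moreover have "\<forall>e'\<in>insert e M. e' \<inter> B \<subseteq> insert v A"
      using M(4) e(3) unfolding W_def by blast
    ultimately show ?case by blast
  qed
  then show ?thesis by blast
qed

text \<open>\<open>S\<close> is the set of heavy vertices, padded to size \<open>s\<close>. A
  maximal matching covers at most \<open>3 * s\<close> vertices, and every edge missing
  \<open>S\<close> meets one of them outside \<open>S\<close>, where degrees are at most
  \<open>4 * s * card V\<close>. The product gives the constant 12.\<close>

lemma exists_transversal_core:
  assumes uni: "uniform 3 (V, E)" and "s \<le> card V"
    and free: "\<not> contains_copy (V, E) (matching3 (s + 1))"
  shows "\<exists>S\<subseteq>V. card S = s \<and> card {e \<in> E. e \<inter> S = {}} \<le> 12 * s\<^sup>2 * card V"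
proof -
  have finV: "finite V" using uni by (simp add: uniform_def)
  note finE = finite_edges[OF uni]
  have small: "card M \<le> s" if "M \<subseteq> E" "pairwise disjnt M" for M
  proof (rule ccontr)
    assume "\<not> card M \<le> s"
    then obtain M' where "M' \<subseteq> M" "card M' = s + 1"
      by (metis Suc_eq_plus1 not_less_eq_eq obtain_subset_with_card_n)
    then show False
      using contains_copy_matching3I[OF uni, of M'] that free pairwise_subset by fastforce
  qed
  define H where "H = {v \<in> V. 4 * s * card V < card {e \<in> E. v \<in> e}}"
  then have "H \<subseteq> V" by blast
  have "card H \<le> s"
  proof (rule ccontr)
    assume "\<not> card H \<le> s"
    then obtain B where B: "B \<subseteq> H" "card B = Suc s" "finite B"
      by (metis not_less_eq_eq obtain_subset_with_card_n)
    have "4 * s * card V < card {e \<in> E. v \<in> e}" if "v \<in> B" for v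
      using that B(1) unfolding H_def by blast
    then obtain M where "M \<subseteq> E" "pairwise disjnt M" "card M = card B"
      using matching_of_heavy_vertices[OF uni B(3), of s] B(2) by auto
    then show False using small[of M] B(2) by simp
  qed
  \<comment> \<open>The padding to exactly \<open>s\<close> vertices leaves exactly \<open>s\<close>
    links on exactly \<open>card V - s\<close> vertices.\<close>
  then obtain S where S: "H \<subseteq> S" "S \<subseteq> V" "card S = s"
    using exists_subset_between[OF _ assms(2) \<open>H \<subseteq> V\<close> finV] by blast
  define Ms where "Ms = {M. M \<subseteq> E \<and> pairwise disjnt M}"
  have "finite Ms" unfolding Ms_def using finE by simp
  moreover have "{} \<in> Ms" unfolding Ms_def by simp
  ultimately obtain M where M: "M \<in> Ms" "\<forall>M'\<in>Ms. M \<subseteq> M' \<longrightarrow> M = M'"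
    using finite_has_maximal[of Ms] by blast
  have ME: "M \<subseteq> E" "pairwise disjnt M" using M(1) unfolding Ms_def by auto
  have "finite M" using ME(1) finE finite_subset by blast
  have e3: "card e = 3 \<and> finite e \<and> e \<subseteq> V" if "e \<in> E" for e
    using uni that finite_subset by (auto simp: uniform_def)
  define W where "W = \<Union>M - S"
  have "card (\<Union>M) \<le> sum card M"
    using \<open>finite M\<close> e3 ME(1) by (intro card_Union_le_sum_card)
  also have "sum card M = 3 * card M" using e3 ME(1) by (simp add: subset_iff)
  finally have "card (\<Union>M) \<le> 3 * s" using small[OF ME] by linarith
  moreover have finM: "finite (\<Union>M)" using \<open>finite M\<close> e3 ME(1) by auto
  ultimately have W: "card W \<le> 3 * s" "finite W"
    unfolding W_def using card_mono[of "\<Union>M" "\<Union>M - S"] by auto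
  have "{e \<in> E. e \<inter> S = {}} \<subseteq> (\<Union>w\<in>W. {e \<in> E. w \<in> e})"
  proof
    fix e
    assume "e \<in> {e \<in> E. e \<inter> S = {}}"
    then have e: "e \<in> E" "e \<inter> S = {}" by auto
    have "e \<inter> \<Union>M \<noteq> {}"
    proof
      assume d: "e \<inter> \<Union>M = {}"
      then have "disjnt e f" "disjnt f e" if "f \<in> M" for f
        using that unfolding disjnt_def by blast+
      then have "insert e M \<in> Ms"
        using ME e(1) by (simp add: Ms_def pairwise_insert)
      \<comment> \<open>Maximality puts \<open>e\<close> into \<open>M\<close>, so \<open>e\<close>
        is both contained in and disjoint from \<open>\<Union>M\<close>; but edges are
        nonempty.\<close>
      then have "M = insert e M" using bspec[OF M(2)] subset_insertI[of M e] by blast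
      then have "e \<subseteq> \<Union>M" by (metis Union_upper insertI1)
      then have "e = {}" using d by (simp add: Int_absorb2)
      then show False using e3[OF e(1)] by simp
    qed
    then show "e \<in> (\<Union>w\<in>W. {e \<in> E. w \<in> e})" using e unfolding W_def by blast
  qed
  then have "card {e \<in> E. e \<inter> S = {}} \<le> card (\<Union>w\<in>W. {e \<in> E. w \<in> e})"
    using finE W(2) by (intro card_mono) auto
  also have "\<dots> \<le> (\<Sum>w\<in>W. card {e \<in> E. w \<in> e})"
    using W(2) by (rule card_UN_le)
  also have "\<dots> \<le> (\<Sum>w\<in>W. 4 * s * card V)"
  proof (rule sum_mono)
    fix w
    assume "w \<in> W"
    then have "w \<in> V" "w \<notin> H" using ME(1) e3 S(1) unfolding W_def by blast+
    then show "card {e \<in> E. w \<in> e} \<le> 4 * s * card V" unfolding H_def by auto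
  qed
  also have "\<dots> = card W * (4 * s * card V)" by simp
  also have "\<dots> \<le> 3 * s * (4 * s * card V)" using W(1) by (rule mult_le_mono1)
  finally show ?thesis using S by (intro exI[of _ S]) (simp add: power2_eq_square mult.assoc)
qed

text \<open>Edges are split by how many vertices they have in \<open>S\<close>: none
  (\<open>E0\<close>, the constant 12), at least two (\<open>E2\<close>), exactly one
  (\<open>E1\<close>, the links). For \<open>E2\<close>, each pair of vertices lies in at most
  \<open>card V\<close> edges, which adds \<open>s^2 * card V\<close> and makes the constant
  13.\<close>

lemma edges_le_links:
  assumes uni: "uniform 3 (V, E)" and "s \<le> card V"
    and free: "\<not> contains_copy (V, E) (matching3 (s + 1))"
  shows "\<exists>S\<subseteq>V. card S = s \<and>
    card E \<le> 13 * s\<^sup>2 * card V + (\<Sum>a\<in>S. card {p. p \<subseteq> V - S \<and> card p = 2 \<and> insert a p \<in> E})"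
proof -
  obtain S where S: "S \<subseteq> V" "card S = s" "card {e \<in> E. e \<inter> S = {}} \<le> 12 * s\<^sup>2 * card V"
    using exists_transversal_core[OF assms] by blast
  have finS: "finite S" "finite V" using uni S(1) finite_subset by (auto simp: uniform_def)
  note finE = finite_edges[OF uni]
  define L where "L a = {p. p \<subseteq> V - S \<and> card p = 2 \<and> insert a p \<in> E}" for a
  have finL: "finite (L a)" for a
    by (rule finite_subset[of _ "Pow V"]) (use finS in \<open>auto simp: L_def\<close>)
  define E0 where "E0 = {e \<in> E. e \<inter> S = {}}"
  define E2 where "E2 = (\<Union>u\<in>S. {e \<in> E. u \<in> e \<and> e \<inter> (S - {u}) \<noteq> {}})"
  define E1 where "E1 = (\<Union>a\<in>S. insert a ` L a)"
  have "E \<subseteq> E0 \<union> E2 \<union> E1"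
  proof
    fix e
    assume e: "e \<in> E"
    then have e3: "e \<subseteq> V" "card e = 3" using uni by (auto simp: uniform_def)
    show "e \<in> E0 \<union> E2 \<union> E1"
    proof (cases "e \<in> E0 \<union> E2")
      case False
      then obtain a where a: "a \<in> S" "a \<in> e" "e \<inter> (S - {a}) = {}"
        using e unfolding E0_def E2_def by blast
      then have "e - {a} \<subseteq> V - S" "card (e - {a}) = 2" "insert a (e - {a}) = e"
        using e3 by auto
      then have "e - {a} \<in> L a" unfolding L_def using e by simp
      then have "e \<in> insert a ` L a" using \<open>insert a (e - {a}) = e\<close> by (metis imageI)
      then show ?thesis unfolding E1_def using a(1) by blast
    qed blast
  qed
  moreover have "finite (E0 \<union> E2 \<union> E1)"
    unfolding E0_def E2_def E1_def using finE finS finL by auto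
  ultimately have "card E \<le> card (E0 \<union> E2 \<union> E1)" by (rule card_mono[rotated])
  also have "\<dots> \<le> card E0 + card E2 + card E1"
    using card_Un_le[of "E0 \<union> E2" E1] card_Un_le[of E0 E2] by linarith
  finally have "card E \<le> card E0 + card E2 + card E1" .
  moreover have "card E0 \<le> 12 * s\<^sup>2 * card V" using S(3) unfolding E0_def .
  moreover have "card E2 \<le> s\<^sup>2 * card V"
  proof -
    have "card E2 \<le> (\<Sum>u\<in>S. card {e \<in> E. u \<in> e \<and> e \<inter> (S - {u}) \<noteq> {}})"
      unfolding E2_def using finS(1) by (rule card_UN_le)
    also have "\<dots> \<le> (\<Sum>u\<in>S. s * card V)"
    proof (rule sum_mono)
      fix u
      assume "u \<in> S"
      have "card {e \<in> E. u \<in> e \<and> e \<inter> (S - {u}) \<noteq> {}} \<le> card (S - {u}) * card V"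
        using uni finS(1) by (intro card_edges_hit_le) auto
      also have "\<dots> \<le> s * card V" using S(2) card_Diff1_le[of S u] by (intro mult_le_mono1) auto
      finally show "card {e \<in> E. u \<in> e \<and> e \<inter> (S - {u}) \<noteq> {}} \<le> s * card V" .
    qed
    also have "\<dots> = s\<^sup>2 * card V" using S(2) by (simp add: power2_eq_square)
    finally show ?thesis .
  qed
  moreover have "card E1 \<le> (\<Sum>a\<in>S. card (L a))"
  proof -
    have "card E1 \<le> (\<Sum>a\<in>S. card (insert a ` L a))"
      unfolding E1_def using finS(1) by (rule card_UN_le)
    also have "\<dots> \<le> (\<Sum>a\<in>S. card (L a))" using finL by (intro sum_mono card_image_le)
    finally show ?thesis .
  qed
  ultimately have "card E \<le> 13 * s\<^sup>2 * card V + (\<Sum>a\<in>S. card (L a))" by linarith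
  then show ?thesis using S(1,2) unfolding L_def by blast
qed

section \<open>Copies of \<open>F_P t\<close>\<close>

text \<open>The indices are reversed: in \<open>F_P\<close> the vertex \<open>a_i\<close> serves
  \<open>i\<close> and the larger \<open>j\<close>, whereas in the chain \<open>b j\<close> serves
  \<open>x j\<close> and its predecessors. Hence \<open>i\<close> is sent to
  \<open>x (Suc k - i)\<close> and \<open>a_i\<close> to \<open>b (Suc k - i)\<close>; the last
  vertex \<open>Suc k\<close> becomes \<open>x 0\<close>, which has no label.\<close>

lemma contains_copy_F_PI:
  assumes "inj_on x {..k}" and "inj_on b {1..k}" and "x ` {..k} \<inter> b ` {1..k} = {}"
    and "x ` {..k} \<subseteq> V" and "b ` {1..k} \<subseteq> V"
    and edge: "\<And>i j. \<lbrakk>i < j; j \<le> k\<rbrakk> \<Longrightarrow> {b j, x j, x i} \<in> E"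
  shows "contains_copy (V, E) (F_P (Suc k))"
proof -
  define f where "f i = (if i \<le> Suc k then x (Suc k - i) else b (Suc k + Suc k - i))" for i
  have verts: "verts (F_P (Suc k)) = {1..Suc k} \<union> {Suc (Suc k)..Suc k + k}"
  proof -
    have "(\<lambda>i. Suc k + i) ` {1..k} = {Suc (Suc k)..Suc k + k}"
      by (simp del: add_Suc)
    then show ?thesis unfolding F_P_def by auto
  qed
  have "inj_on f {1..Suc k}"
  proof (rule inj_onI)
    fix i j
    assume "i \<in> {1..Suc k}" "j \<in> {1..Suc k}" "f i = f j"
    then have "Suc k - i = Suc k - j"
      by (intro inj_onD[OF assms(1)]) (auto simp: f_def)
    then show "i = j"
      using \<open>i \<in> {1..Suc k}\<close> \<open>j \<in> {1..Suc k}\<close> by (metis atLeastAtMost_iff diff_diff_cancel)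
  qed
  moreover have "inj_on f {Suc (Suc k)..Suc k + k}"
  proof (rule inj_onI)
    fix i j
    assume ij: "i \<in> {Suc (Suc k)..Suc k + k}" "j \<in> {Suc (Suc k)..Suc k + k}" "f i = f j"
    then have "Suc k + Suc k - i = Suc k + Suc k - j"
      by (intro inj_onD[OF assms(2)]) (auto simp: f_def)
    moreover have "i \<le> Suc k + Suc k" "j \<le> Suc k + Suc k" using ij(1,2) by auto
    ultimately show "i = j" by (metis diff_diff_cancel)
  qed
  moreover have fx: "f ` {1..Suc k} \<subseteq> x ` {..k}" unfolding f_def by auto
  moreover have fb: "f ` {Suc (Suc k)..Suc k + k} \<subseteq> b ` {1..k}"
    unfolding f_def by (auto intro!: imageI)
  ultimately have "inj_on f (verts (F_P (Suc k)))"
    unfolding verts inj_on_Un using assms(3) by blast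
  moreover have "f ` verts (F_P (Suc k)) \<subseteq> V"
    unfolding verts image_Un using fx fb assms(4,5) by blast
  moreover have "f ` e \<in> E" if "e \<in> hedges (F_P (Suc k))" for e
  proof -
    obtain i j where e: "e = {Suc k + i, i, j}" "1 \<le> i" "i < j" "j \<le> Suc k"
      using \<open>e \<in> hedges (F_P (Suc k))\<close> unfolding F_P_def by auto
    then have "f ` e = {b (Suc k - i), x (Suc k - i), x (Suc k - j)}"
      unfolding f_def by simp
    then show ?thesis using edge[of "Suc k - j" "Suc k - i"] e by simp
  qed
  ultimately show ?thesis unfolding contains_copy_def by auto
qed

section \<open>Lower-bound construction: joining apex vertices to a graph\<close>

definition join_graph :: "nat \<Rightarrow> nat \<Rightarrow> nat set set \<Rightarrow> nat hypergraph" where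
  "join_graph m s G = ({..<m + s}, (\<lambda>(v, p). insert v p) ` ({m..<m + s} \<times> G))"

text \<open>Apexes are recognised by \<open>m \<le> a\<close>, and every edge has exactly one. Only
  the first position is treated; the others follow by permuting the set.\<close>

lemma join_graph_edgeD:
  assumes "G \<subseteq> {p. p \<subseteq> {..<m} \<and> card p = 2}"
    and "{a, b, c} \<in> hedges (join_graph m s G)" and "a \<noteq> b" "a \<noteq> c"
  shows "m \<le> a \<or> m \<le> b \<or> m \<le> c"
    and "m \<le> a \<Longrightarrow> b < m \<and> c < m \<and> a < m + s \<and> {b, c} \<in> G"
proof -
  obtain v p where vp: "{a, b, c} = insert v p" "m \<le> v" "v < m + s" "p \<in> G" "p \<subseteq> {..<m}"
    using assms(1,2) unfolding join_graph_def by auto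
  have "v \<in> {a, b, c}" unfolding vp(1) by simp
  then show "m \<le> a \<or> m \<le> b \<or> m \<le> c" using vp(2) by auto
  assume "m \<le> a"
  then have "a = v" using vp(1,5) by (metis insertE insertI1 lessThan_iff not_less subsetD)
  have "v \<notin> p" using vp(2,5) by auto
  then have "p = {a, b, c} - {v}" unfolding vp(1) by simp
  also have "\<dots> = {b, c}" using \<open>a = v\<close> assms(3,4) by auto
  finally have "p = {b, c}" .
  then show "b < m \<and> c < m \<and> a < m + s \<and> {b, c} \<in> G"
    using vp(3,4,5) \<open>a = v\<close> by auto
qed

lemma uniform_join_graph:
  assumes "G \<subseteq> {p. p \<subseteq> {..<m} \<and> card p = 2}"
  shows "uniform 3 (join_graph m s G)"
  unfolding uniform_def
proof (intro conjI ballI)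
  show "finite (verts (join_graph m s G))" by (simp add: join_graph_def)
next
  fix e
  assume "e \<in> hedges (join_graph m s G)"
  then obtain v p where vp: "e = insert v p" "m \<le> v" "v < m + s" "p \<subseteq> {..<m}" "card p = 2"
    using assms unfolding join_graph_def by auto
  then have "v \<notin> p" "finite p" using finite_subset by auto
  then show "card e = 3" using vp(1,5) by simp
  show "e \<subseteq> verts (join_graph m s G)" using vp unfolding join_graph_def by auto
qed

lemma card_join_graph:
  assumes "G \<subseteq> {p. p \<subseteq> {..<m} \<and> card p = 2}"
  shows "card (hedges (join_graph m s G)) = s * card G"
proof -
  have "inj_on (\<lambda>(v, p). insert v p) ({m..<m + s} \<times> G)"
  proof (rule inj_onI, clarify)
    fix v p w q
    assume *: "v \<in> {m..<m + s}" "w \<in> {m..<m + s}" "p \<in> G" "q \<in> G" "insert v p = insert w q"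
    \<comment> \<open>Cutting an edge at \<open>m\<close> recovers both its apex and its edge of
      \<open>G\<close>.\<close>
    have split: "{x} = insert x r - {..<m} \<and> r = insert x r \<inter> {..<m}"
      if "x \<in> {m..<m + s}" "r \<in> G" for x r
    proof -
      have "r \<subseteq> {..<m}" using assms that(2) by auto
      then show ?thesis using that(1) by auto
    qed
    from split[OF *(1,3)] split[OF *(2,4)] show "v = w \<and> p = q"
      unfolding *(5) by (metis singleton_inject)
  qed
  then show ?thesis unfolding join_graph_def by (simp add: card_image card_cartesian_product)
qed

text \<open>Pigeonhole: \<open>s + 1\<close> disjoint edges would need \<open>s + 1\<close>
  different apexes. Below, \<open>r i\<close> is the position of an apex within the
  \<open>i\<close>-th edge.\<close>

lemma join_graph_matching_free:
  assumes "G \<subseteq> {p. p \<subseteq> {..<m} \<and> card p = 2}"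
  shows "\<not> contains_copy (join_graph m s G) (matching3 (s + 1))"
proof
  assume "contains_copy (join_graph m s G) (matching3 (s + 1))"
  then obtain f where f: "inj_on f {..<3 * (s + 1)}"
    "\<And>e. e \<in> hedges (matching3 (s + 1)) \<Longrightarrow> f ` e \<in> hedges (join_graph m s G)"
    unfolding contains_copy_def matching3_def by auto
  have "\<exists>r<3. f (3 * i + r) \<in> {m..<m + s}" if "i < s + 1" for i
  proof -
    have "{3 * i, 3 * i + 1, 3 * i + 2} \<in> hedges (matching3 (s + 1))"
      using that unfolding matching3_def by auto
    from f(2)[OF this] obtain v p
      where vp: "f ` {3 * i, 3 * i + 1, 3 * i + 2} = insert v p" "v \<in> {m..<m + s}"
      unfolding join_graph_def by auto
    have "v \<in> f ` {3 * i, 3 * i + 1, 3 * i + 2}" unfolding vp(1) by (rule insertI1)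
    then obtain x where x: "x \<in> {3 * i, 3 * i + 1, 3 * i + 2}" "v = f x" by (rule imageE)
    have "x - 3 * i < 3" "3 * i + (x - 3 * i) = x" using x(1) by auto
    then show ?thesis using vp(2) x(2) by metis
  qed
  then obtain r where r: "\<And>i. i < s + 1 \<Longrightarrow> r i < 3"
    "\<And>i. i < s + 1 \<Longrightarrow> f (3 * i + r i) \<in> {m..<m + s}" by metis
  have "inj_on (\<lambda>i. f (3 * i + r i)) {..<s + 1}"
  proof (rule inj_onI)
    fix i j
    assume ij: "i \<in> {..<s + 1}" "j \<in> {..<s + 1}" "f (3 * i + r i) = f (3 * j + r j)"
    have "r i < 3" "r j < 3" using ij r(1) by auto
    moreover have "3 * i + r i \<in> {..<3 * (s + 1)}" "3 * j + r j \<in> {..<3 * (s + 1)}"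
      using ij(1,2) \<open>r i < 3\<close> \<open>r j < 3\<close> by auto
    then have "3 * i + r i = 3 * j + r j" using f(1) ij(3) inj_onD by metis
    ultimately show "i = j" by linarith
  qed
  moreover have "(\<lambda>i. f (3 * i + r i)) ` {..<s + 1} \<subseteq> {m..<m + s}" using r(2) by auto
  ultimately have "card {..<s + 1} \<le> card {m..<m + s}" by (intro card_inj_on_le) auto
  then show False by simp
qed

text \<open>The apex vertices of the join pull back to a set meeting every edge of \<open>F_P t\<close> exactly once.
  For \<open>t \<ge> 4\<close> there are just two such sets: all the \<open>a_i\<close>, or the \<open>a_i\<close> with \<open>a_1\<close> replaced by \<open>1\<close>.
  Either way it has \<open>t - 1\<close> elements and the links form a clique of order \<open>t\<close>.\<close>

lemma F_P_copy_in_join_graph: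
  assumes G: "G \<subseteq> {p. p \<subseteq> {..<m} \<and> card p = 2}" and "t \<ge> 4"
    and copy: "contains_copy (join_graph m s G) (F_P t)"
  shows "t - 1 \<le> s" and "\<exists>z. \<forall>i j. 1 \<le> i \<and> i < j \<and> j \<le> t \<longrightarrow> {z i, z j} \<in> G"
proof -
  obtain f where f: "inj_on f (verts (F_P t))"
    "\<And>e. e \<in> hedges (F_P t) \<Longrightarrow> f ` e \<in> hedges (join_graph m s G)"
    using copy unfolding contains_copy_def by auto
  have vF: "i \<in> verts (F_P t)" if "1 \<le> i" "i \<le> t + (t - 1)" for i
  proof (cases "i \<le> t")
    case False
    then have "i = t + (i - t)" "i - t \<in> {1..t - 1}" using that by auto
    then show ?thesis unfolding F_P_def by (metis UnI1 fst_conv imageI)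
  qed (use that in \<open>simp add: F_P_def\<close>)
  have feq: "f i = f j \<longleftrightarrow> i = j" if "1 \<le> i" "i \<le> t + (t - 1)" "1 \<le> j" "j \<le> t + (t - 1)" for i j
    using inj_on_eq_iff[OF f(1)] vF that by blast
  \<comment> \<open>\<open>P\<close> marks the vertices sent to apexes; the facts \<open>E\<close>
    say that each edge \<open>{a_i, i, j}\<close> has exactly one of them.\<close>
  define P where "P i \<longleftrightarrow> m \<le> f i" for i
  have E: "P (t + i) \<or> P i \<or> P j"
      "P (t + i) \<Longrightarrow> \<not> P i \<and> \<not> P j \<and> f (t + i) < m + s \<and> {f i, f j} \<in> G"
      "P i \<Longrightarrow> \<not> P (t + i) \<and> \<not> P j \<and> f i < m + s \<and> {f (t + i), f j} \<in> G"
      "P j \<Longrightarrow> \<not> P (t + i) \<and> \<not> P i"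
    if "1 \<le> i" "i < j" "j \<le> t" for i j
  proof -
    have "1 \<le> i \<and> i \<le> t - 1 \<and> i < j \<and> j \<le> t" using that by auto
    then have "{t + i, i, j} \<in> hedges (F_P t)" unfolding F_P_def by auto
    then have "f ` {t + i, i, j} \<in> hedges (join_graph m s G)" by (rule f(2))
    then have e: "{f (t + i), f i, f j} \<in> hedges (join_graph m s G)" by simp
    then have e': "{f i, f (t + i), f j} \<in> hedges (join_graph m s G)"
      "{f j, f (t + i), f i} \<in> hedges (join_graph m s G)" by (simp_all add: insert_commute)
    have ne: "f (t + i) \<noteq> f i" "f (t + i) \<noteq> f j" "f i \<noteq> f j"
      using that feq[of "t + i" i] feq[of "t + i" j] feq[of i j] by auto
    note D = join_graph_edgeD[OF G]
    show "P (t + i) \<or> P i \<or> P j" unfolding P_def using D(1)[OF e ne(1,2)] .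
    show "P (t + i) \<Longrightarrow> \<not> P i \<and> \<not> P j \<and> f (t + i) < m + s \<and> {f i, f j} \<in> G"
      unfolding P_def using D(2)[OF e ne(1,2)] by auto
    show "P i \<Longrightarrow> \<not> P (t + i) \<and> \<not> P j \<and> f i < m + s \<and> {f (t + i), f j} \<in> G"
      unfolding P_def using D(2)[OF e'(1) ne(1)[symmetric] ne(3)] by auto
    show "P j \<Longrightarrow> \<not> P (t + i) \<and> \<not> P i"
      unfolding P_def using D(2)[OF e'(2) ne(2,3)[symmetric]] by auto
  qed
  \<comment> \<open>If \<open>i \<ge> 2\<close> went to an apex, the edge \<open>{a_1, 1, i}\<close>
    would keep \<open>a_1\<close> and \<open>1\<close> off the apexes. Then
    \<open>{a_1, 1, j}\<close> makes any other \<open>j \<ge> 2\<close> an apex, and the edge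
    containing both \<open>i\<close> and \<open>j\<close> has two.\<close>
  have notP: "\<not> P i" if "2 \<le> i" "i \<le> t" for i
  proof
    assume "P i"
    define j :: nat where "j = (if i = 2 then 3 else 2)"
    have j: "2 \<le> j" "j \<le> t" "i \<noteq> j" using \<open>t \<ge> 4\<close> by (auto simp: j_def)
    have "\<not> P (t + 1)" "\<not> P 1" using E(4)[of 1 i] \<open>P i\<close> that by auto
    then have "P j" using E(1)[of 1 j] j by auto
    show False
    proof (cases "i < j")
      case True
      then show False using E(4)[of i j] \<open>P i\<close> \<open>P j\<close> that j by auto
    next
      case False
      then show False using E(4)[of j i] \<open>P i\<close> \<open>P j\<close> that j by auto
    qed
  qed
  \<comment> \<open>\<open>c i\<close> is the vertex of \<open>{a_i, i, j}\<close> sent to an apex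
    and \<open>y i\<close> the one that joins the clique; only for \<open>i = 1\<close> can the two
    roles be swapped.\<close>
  define y where "y i = (if i = 1 \<and> P 1 then t + 1 else i)" for i
  define c where "c i = (if i = 1 \<and> P 1 then 1 else t + i)" for i
  have c: "P (c i) \<and> f (c i) < m + s \<and> {f (y i), f j} \<in> G" if "1 \<le> i" "i < j" "j \<le> t" for i j
  proof (cases "i = 1 \<and> P 1")
    case True
    then show ?thesis using E(3)[of 1 j] that unfolding c_def y_def by auto
  next
    case False
    then have "\<not> P i" using notP[of i] that by (cases "i = 1") auto
    moreover have "\<not> P j" using notP[of j] that by auto
    ultimately have "P (t + i)" using E(1)[OF that] by blast
    then show ?thesis using E(2)[OF that] False unfolding c_def y_def by auto
  qed
  have "inj_on (\<lambda>i. f (c i)) {1..t - 1}"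
  proof (rule inj_onI)
    fix i j
    assume ij: "i \<in> {1..t - 1}" "j \<in> {1..t - 1}" "f (c i) = f (c j)"
    have range: "1 \<le> c r" "c r \<le> t + (t - 1)" if "r \<in> {1..t - 1}" for r
      using that by (auto simp: c_def)
    have "c i = c j" using ij(3) feq[OF range[OF ij(1)] range[OF ij(2)]] by blast
    then have "(if i = 1 \<and> P 1 then 1 else t + i) = (if j = 1 \<and> P 1 then 1 else t + j)"
      unfolding c_def .
    then show "i = j"
      using \<open>t \<ge> 4\<close> by (cases "i = 1"; cases "j = 1"; cases "P 1") simp_all
  qed
  moreover have "(\<lambda>i. f (c i)) ` {1..t - 1} \<subseteq> {m..<m + s}"
  proof
    fix v
    assume "v \<in> (\<lambda>i. f (c i)) ` {1..t - 1}"
    then obtain i where "i \<in> {1..t - 1}" "v = f (c i)" by auto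
    then show "v \<in> {m..<m + s}" using c[of i t] unfolding P_def by auto
  qed
  ultimately have "card {1..t - 1} \<le> card {m..<m + s}" by (intro card_inj_on_le) auto
  then show "t - 1 \<le> s" by simp
  \<comment> \<open>Since \<open>j > 1\<close>, \<open>y j\<close> is just \<open>j\<close>.\<close>
  have "{f (y i), f (y j)} \<in> G" if "1 \<le> i" "i < j" "j \<le> t" for i j
    using c[OF that] that unfolding y_def by simp
  then show "\<exists>z. \<forall>i j. 1 \<le> i \<and> i < j \<and> j \<le> t \<longrightarrow> {z i, z j} \<in> G"
    by (intro exI[of _ "\<lambda>i. f (y i)"]) blast
qed

text \<open>Pigeonhole on the residues modulo \<open>k\<close>, which differ along every
  edge.\<close>

lemma turan_graph_clique_free:
  assumes "k > 0"
  shows "\<nexists>z. \<forall>i j. 1 \<le> i \<and> i < j \<and> j \<le> Suc k \<longrightarrow> {z i, z j} \<in> hedges (turan_graph n k)"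
proof
  assume "\<exists>z. \<forall>i j. 1 \<le> i \<and> i < j \<and> j \<le> Suc k \<longrightarrow> {z i, z j} \<in> hedges (turan_graph n k)"
  then obtain z where z: "\<And>i j. \<lbrakk>1 \<le> i; i < j; j \<le> Suc k\<rbrakk> \<Longrightarrow> {z i, z j} \<in> hedges (turan_graph n k)"
    by blast
  have ne: "z i mod k \<noteq> z j mod k" if "1 \<le> i" "i < j" "j \<le> Suc k" for i j
    using z[OF that] unfolding hedges_turan_graph[OF assms] by (auto simp: doubleton_eq_iff)
  have "inj_on (\<lambda>i. z i mod k) {1..Suc k}"
    by (rule linorder_inj_onI) (use ne in auto)
  moreover have "(\<lambda>i. z i mod k) ` {1..Suc k} \<subseteq> {..<k}" using assms by auto
  ultimately have "card {1..Suc k} \<le> card {..<k}" by (intro card_inj_on_le) auto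
  then show False by simp
qed

section \<open>The extremal number as an attained maximum\<close>

text \<open>Infinitely many vertex sets have size \<open>n\<close>, but the edge counts are bounded
  by \<open>2 ^ n\<close>, so the maximum is over a finite set.\<close>

lemma finite_ex3_set:
  "finite {card (hedges H) | H :: nat hypergraph.
     uniform 3 H \<and> card (verts H) = n \<and> (\<forall>F\<in>\<F>. \<not> contains_copy H F)}"
proof (rule finite_subset)
  show "{card (hedges H) | H :: nat hypergraph.
     uniform 3 H \<and> card (verts H) = n \<and> (\<forall>F\<in>\<F>. \<not> contains_copy H F)} \<subseteq> {..2 ^ n}"
  proof clarsimp
    fix V :: "nat set" and E
    assume "uniform 3 (V, E)"
    then have "E \<subseteq> Pow V" "finite V" by (auto simp: uniform_def)
    then show "card E \<le> 2 ^ card V" using card_mono[of "Pow V" E] by (simp add: card_Pow)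
  qed
qed simp

lemma ex3_ge:
  fixes H :: "nat hypergraph"
  assumes "uniform 3 H" and "card (verts H) = n" and "\<And>F. F \<in> \<F> \<Longrightarrow> \<not> contains_copy H F"
  shows "card (hedges H) \<le> ex3 n \<F>"
  unfolding ex3_def using assms by (intro Max_ge finite_ex3_set) blast

text \<open>The witness \<open>H0\<close> makes the set of edge counts nonempty; the value of
  \<open>Max\<close> on an empty set would carry no information.\<close>

lemma ex3_attained:
  fixes H0 :: "nat hypergraph"
  assumes "uniform 3 H0" and "card (verts H0) = n" and "\<And>F. F \<in> \<F> \<Longrightarrow> \<not> contains_copy H0 F"
  obtains V :: "nat set" and E where "uniform 3 (V, E)" "card V = n" "\<And>F. F \<in> \<F> \<Longrightarrow> \<not> contains_copy (V, E) F"
    "ex3 n \<F> = card E"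
proof -
  let ?X = "{card (hedges H) | H :: nat hypergraph.
     uniform 3 H \<and> card (verts H) = n \<and> (\<forall>F\<in>\<F>. \<not> contains_copy H F)}"
  have "?X \<noteq> {}" using assms by blast
  then have "ex3 n \<F> \<in> ?X" unfolding ex3_def by (intro Max_in finite_ex3_set)
  then show thesis using that by auto
qed

section \<open>Link graphs of a hypergraph without \<open>F_P t\<close>\<close>

text \<open>The vertices of \<open>S\<close> act as labels: \<open>adj a\<close> is adjacency in the
  link of \<open>a\<close>. A rainbow clique on \<open>V - S\<close> is a copy of
  \<open>F_P\<close>, its labels being distinct vertices outside the clique, so
  \<open>rainbow_clique_bound\<close> applies. The factor 2 comes from counting ordered
  pairs.\<close>

lemma link_sum_bound:
  assumes uni: "uniform 3 (V, E)" and S: "S \<subseteq> V" "Suc l \<le> card S"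
    and free: "\<not> contains_copy (V, E) (F_P (Suc (Suc l)))"
  shows "2 * Suc l * (\<Sum>a\<in>S. card {p. p \<subseteq> V - S \<and> card p = 2 \<and> insert a p \<in> E})
    \<le> card S * l * (card (V - S))\<^sup>2 + card S * Suc l * card (V - S)"
proof -
  define U where "U = V - S"
  have fin: "finite V" "finite S" "finite U"
    using uni S(1) finite_subset by (auto simp: uniform_def U_def)
  define adj where "adj a u v \<longleftrightarrow> {a, u, v} \<in> E" for a u v
  have sym: "adj a u v \<Longrightarrow> adj a v u" for a u v
    unfolding adj_def by (simp add: insert_commute)
  define L where "L a = {p. p \<subseteq> U \<and> card p = 2 \<and> insert a p \<in> E}" for a
  have finL: "finite (L a)" for a
    by (rule finite_subset[of _ "Pow U"]) (use fin in \<open>auto simp: L_def\<close>)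
  have "2 * card (L a) \<le> (\<Sum>u\<in>U. \<Sum>v\<in>U. if adj a u v then 1 else 0)" for a
  proof -
    have "2 * card (L a) = card {(u, v). {u, v} \<in> L a}"
      using finL by (intro card_ordered_pairs[symmetric]) (auto simp: L_def)
    also have "\<dots> \<le> card {q \<in> U \<times> U. adj a (fst q) (snd q)}"
      using fin by (intro card_mono) (auto simp: L_def adj_def)
    also have "\<dots> = (\<Sum>q\<in>U \<times> U. if adj a (fst q) (snd q) then 1 else 0)"
      using fin by (simp add: sum.If_cases Int_def)
    also have "\<dots> = (\<Sum>u\<in>U. \<Sum>v\<in>U. if adj a u v then 1 else 0)"
      by (simp add: sum.cartesian_product case_prod_beta)
    finally show ?thesis .
  qed
  then have "(\<Sum>a\<in>S. 2 * card (L a)) \<le> (\<Sum>a\<in>S. \<Sum>u\<in>U. \<Sum>v\<in>U. if adj a u v then 1 else 0)"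
    by (intro sum_mono)
  \<comment> \<open>Double counting: the sum over labels is moved innermost, where it becomes the
    number of labels on the pair \<open>u\<close>, \<open>v\<close>.\<close>
  also have "\<dots> = (\<Sum>u\<in>U. \<Sum>a\<in>S. \<Sum>v\<in>U. if adj a u v then 1 else 0)"
    by (rule sum.swap)
  also have "\<dots> = (\<Sum>u\<in>U. \<Sum>v\<in>U. \<Sum>a\<in>S. if adj a u v then 1 else 0)"
    by (intro sum.cong refl sum.swap)
  also have "\<dots> = (\<Sum>u\<in>U. \<Sum>v\<in>U. card {a \<in> S. adj a u v})"
    using fin by (simp add: sum.If_cases Int_def)
  finally have "2 * (\<Sum>a\<in>S. card (L a)) \<le> (\<Sum>u\<in>U. \<Sum>v\<in>U. card {a \<in> S. adj a u v})"
    by (simp add: sum_distrib_left)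
  then have "Suc l * (2 * (\<Sum>a\<in>S. card (L a))) \<le> Suc l * (\<Sum>u\<in>U. \<Sum>v\<in>U. card {a \<in> S. adj a u v})"
    by (rule mult_le_mono2)
  also have "\<dots> \<le> card S * l * (card U)\<^sup>2 + card S * Suc l * card U"
  proof (rule rainbow_clique_bound[OF fin(2) S(2) fin(3) sym], assumption, intro notI, elim exE conjE)
    fix x b
    assume *: "inj_on x {..Suc l}" "x ` {..Suc l} \<subseteq> U" "inj_on b {1..Suc l}"
      "b ` {1..Suc l} \<subseteq> S" "\<forall>j\<in>{1..Suc l}. \<forall>i<j. adj (b j) (x j) (x i)"
    have "contains_copy (V, E) (F_P (Suc (Suc l)))"
    proof (rule contains_copy_F_PI[OF *(1,3)])
      show "x ` {..Suc l} \<inter> b ` {1..Suc l} = {}" "x ` {..Suc l} \<subseteq> V" "b ` {1..Suc l} \<subseteq> V"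
        using *(2,4) S(1) unfolding U_def by blast+
      show "{b j, x j, x i} \<in> E" if "i < j" "j \<le> Suc l" for i j
        using *(5) that unfolding adj_def by simp
    qed
    with free show False ..
  qed
  finally show ?thesis unfolding L_def U_def by (simp only: ac_simps)
qed

section \<open>The two cases of the theorem\<close>

text \<open>The join excludes \<open>F_P t\<close> in one of two ways: too few apexes, or no clique
  of order \<open>t\<close> in \<open>G\<close>. It serves twice, as the lower bound and as the
  witness that an extremal hypergraph exists.\<close>

lemma ex3_lower:
  assumes "G \<subseteq> {p. p \<subseteq> {..<n - s} \<and> card p = 2}" and "s \<le> n" and "t \<ge> 4"
    and "s < t - 1 \<or> \<not> (\<exists>z. \<forall>i j. 1 \<le> i \<and> i < j \<and> j \<le> t \<longrightarrow> {z i, z j} \<in> G)"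
  shows "s * card G \<le> ex3 n {F_P t, matching3 (s + 1)}"
    and "\<exists>(V :: nat set) E. uniform 3 (V, E) \<and> card V = n \<and> \<not> contains_copy (V, E) (F_P t) \<and>
      \<not> contains_copy (V, E) (matching3 (s + 1)) \<and> ex3 n {F_P t, matching3 (s + 1)} = card E"
proof -
  let ?H = "join_graph (n - s) s G"
  have H: "uniform 3 ?H" "card (verts ?H) = n"
    using assms(2) by (simp_all add: uniform_join_graph[OF assms(1)]) (simp add: join_graph_def)
  have free: "\<not> contains_copy ?H F" if "F \<in> {F_P t, matching3 (s + 1)}" for F
  proof -
    have "\<not> contains_copy ?H (F_P t)"
      using F_P_copy_in_join_graph[OF assms(1,3)] assms(4) by (meson not_le)
    then show ?thesis using that join_graph_matching_free[OF assms(1)] by blast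
  qed
  show "s * card G \<le> ex3 n {F_P t, matching3 (s + 1)}"
    using ex3_ge[OF H, of "{F_P t, matching3 (s + 1)}"] free card_join_graph[OF assms(1)] by metis
  show "\<exists>(V :: nat set) E. uniform 3 (V, E) \<and> card V = n \<and> \<not> contains_copy (V, E) (F_P t) \<and>
      \<not> contains_copy (V, E) (matching3 (s + 1)) \<and> ex3 n {F_P t, matching3 (s + 1)} = card E"
    by (rule ex3_attained[OF H free]) blast+
qed

lemma ex3_complete:
  assumes "s \<le> n" and "t \<ge> 4" and "s \<le> t - 2"
  shows "s * ((n - s) choose 2) \<le> ex3 n {F_P t, matching3 (s + 1)}"
    and "ex3 n {F_P t, matching3 (s + 1)} \<le> s * ((n - s) choose 2) + 13 * s\<^sup>2 * n"
proof -
  define G where "G = {p. p \<subseteq> {..<n - s} \<and> card p = 2}"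
  have G: "G \<subseteq> {p. p \<subseteq> {..<n - s} \<and> card p = 2}" "card G = (n - s) choose 2"
    unfolding G_def by (simp_all add: n_subsets)
  have "s < t - 1" using assms(2,3) by linarith
  note lower = ex3_lower[OF G(1) assms(1,2) disjI1[OF this]]
  show "s * ((n - s) choose 2) \<le> ex3 n {F_P t, matching3 (s + 1)}"
    using lower(1) G(2) by simp
  obtain V :: "nat set" and E where VE: "uniform 3 (V, E)" "card V = n" "\<not> contains_copy (V, E) (matching3 (s + 1))"
    "ex3 n {F_P t, matching3 (s + 1)} = card E"
    using lower(2) by blast
  obtain S where S: "S \<subseteq> V" "card S = s"
    "card E \<le> 13 * s\<^sup>2 * card V + (\<Sum>a\<in>S. card {p. p \<subseteq> V - S \<and> card p = 2 \<and> insert a p \<in> E})"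
    using edges_le_links[OF VE(1) _ VE(3)] VE(2) assms(1) by auto
  have fin: "finite V" "finite S" using VE(1) S(1) finite_subset by (auto simp: uniform_def)
  have U: "card (V - S) = n - s" using S fin VE(2) by (simp add: card_Diff_subset)
  have "card {p. p \<subseteq> V - S \<and> card p = 2 \<and> insert a p \<in> E} \<le> (n - s) choose 2" for a
  proof -
    have "card {p. p \<subseteq> V - S \<and> card p = 2 \<and> insert a p \<in> E} \<le> card {p. p \<subseteq> V - S \<and> card p = 2}"
      using fin by (intro card_mono) auto
    then show ?thesis using n_subsets[of "V - S" 2] fin U by simp
  qed
  then have "(\<Sum>a\<in>S. card {p. p \<subseteq> V - S \<and> card p = 2 \<and> insert a p \<in> E}) \<le> (\<Sum>a\<in>S. (n - s) choose 2)"
    by (intro sum_mono)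
  then show "ex3 n {F_P t, matching3 (s + 1)} \<le> s * ((n - s) choose 2) + 13 * s\<^sup>2 * n"
    using S(2,3) VE(2,4) by simp
qed

lemma ex3_turan:
  assumes "s \<le> n" and "t \<ge> 4" and "t - 1 \<le> s"
  shows "s * turan_num (n - s) (t - 1) \<le> ex3 n {F_P t, matching3 (s + 1)}"
    and "ex3 n {F_P t, matching3 (s + 1)} \<le> s * turan_num (n - s) (t - 1) + (13 * s\<^sup>2 + s) * n"
proof -
  have "t = Suc (Suc (t - 2))" using assms(2) by simp
  then obtain l where t: "t = Suc (Suc l)" ..
  define G where "G = hedges (turan_graph (n - s) (Suc l))"
  have G: "G \<subseteq> {p. p \<subseteq> {..<n - s} \<and> card p = 2}"
    unfolding G_def hedges_turan_graph[OF zero_less_Suc] by (auto simp: card_insert_if)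
  have "\<not> (\<exists>z. \<forall>i j. 1 \<le> i \<and> i < j \<and> j \<le> t \<longrightarrow> {z i, z j} \<in> G)"
    unfolding G_def t by (rule turan_graph_clique_free) simp
  note lower = ex3_lower[OF G assms(1,2) disjI2[OF this]]
  show "s * turan_num (n - s) (t - 1) \<le> ex3 n {F_P t, matching3 (s + 1)}"
    using lower(1) unfolding G_def turan_num_def t by simp
  obtain V :: "nat set" and E where VE: "uniform 3 (V, E)" "card V = n" "\<not> contains_copy (V, E) (F_P t)"
    "\<not> contains_copy (V, E) (matching3 (s + 1))"
    "ex3 n {F_P t, matching3 (s + 1)} = card E"
    using lower(2) by blast
  obtain S where S: "S \<subseteq> V" "card S = s"
    "card E \<le> 13 * s\<^sup>2 * card V + (\<Sum>a\<in>S. card {p. p \<subseteq> V - S \<and> card p = 2 \<and> insert a p \<in> E})"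
    using edges_le_links[OF VE(1) _ VE(4)] VE(2) assms(1) by auto
  define X where "X = (\<Sum>a\<in>S. card {p. p \<subseteq> V - S \<and> card p = 2 \<and> insert a p \<in> E})"
  define m where "m = n - s"
  define T where "T = turan_num m (Suc l)"
  have fin: "finite V" "finite S" using VE(1) S(1) finite_subset by (auto simp: uniform_def)
  have U: "card (V - S) = m" using S fin VE(2) unfolding m_def by (simp add: card_Diff_subset)
  have "2 * Suc l * X \<le> s * l * m\<^sup>2 + s * Suc l * m"
    using link_sum_bound[OF VE(1) S(1), of l] VE(3) assms(3) S(2) U unfolding X_def t by simp
  also have "s * l * m\<^sup>2 \<le> s * (2 * Suc l * T + Suc l * m)"
  proof -
    \<comment> \<open>This is \<open>turan_num_ge\<close> with one copy of \<open>m^2\<close>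
      cancelled, as \<open>Suc l * m^2 = l * m^2 + m^2\<close>.\<close>
    have "l * m\<^sup>2 \<le> 2 * Suc l * T + Suc l * m"
      using turan_num_ge[of "Suc l" m] unfolding T_def by simp
    then show ?thesis by (metis mult.assoc mult_le_mono2)
  qed
  \<comment> \<open>The two linear terms, each \<open>s * Suc l * m\<close>, add up to
    \<open>2 * Suc l * s * m\<close>, so the factor \<open>2 * Suc l\<close> can be cancelled
    throughout.\<close>
  finally have "2 * Suc l * X \<le> 2 * Suc l * (s * (T + m))"
    by (simp add: algebra_simps)
  then have "X \<le> s * (T + m)" by (metis mult_le_cancel1 zero_less_Suc mult_pos_pos pos2)
  also have "\<dots> \<le> s * T + s * n" unfolding m_def by (simp add: distrib_left)
  finally show "ex3 n {F_P t, matching3 (s + 1)} \<le> s * turan_num (n - s) (t - 1) + (13 * s\<^sup>2 + s) * n"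
    using S(3) VE(2,5) unfolding X_def T_def m_def t by (simp add: algebra_simps)
qed

lemma bigo_linearI:
  fixes f g :: "nat \<Rightarrow> nat"
  assumes "\<And>n. N \<le> n \<Longrightarrow> g n \<le> f n" and "\<And>n. N \<le> n \<Longrightarrow> f n \<le> g n + C * n"
  shows "(\<lambda>n. real (f n) - real (g n)) \<in> O(\<lambda>n. real n)"
proof (rule bigoI[of _ "real C"], rule eventually_sequentiallyI[of N])
  fix n
  assume "N \<le> n"
  then have "real (g n) \<le> real (f n)" "real (f n) \<le> real (g n + C * n)"
    using assms of_nat_le_iff by blast+
  then show "norm (real (f n) - real (g n)) \<le> real C * norm (real n)" by simp
qed

theorem theorem1p4:
  fixes s t :: nat
  assumes "s \<ge> 1" and "t \<ge> 4"
  shows "(s \<le> t - 2 \<longrightarrow>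
           (\<lambda>n. real (ex3 n {F_P t, matching3 (s + 1)}) - real s * real ((n - s) choose 2))
             \<in> O(\<lambda>n. real n)) \<and>
         (s \<ge> t - 1 \<longrightarrow>
           (\<lambda>n. real (ex3 n {F_P t, matching3 (s + 1)}) - real s * real (turan_num (n - s) (t - 1)))
             \<in> O(\<lambda>n. real n))"
  unfolding of_nat_mult[symmetric]
proof (intro conjI impI)
  assume "s \<le> t - 2"
  then show "(\<lambda>n. real (ex3 n {F_P t, matching3 (s + 1)}) - real (s * ((n - s) choose 2)))
    \<in> O(\<lambda>n. real n)"
    \<comment> \<open>The threshold is \<open>n \<ge> s\<close>, from where on \<open>s\<close>
      apexes fit and \<open>n - s\<close> is not truncated.\<close>
    using assms(2) by (intro bigo_linearI[of s _ _ "13 * s\<^sup>2"] ex3_complete)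
next
  assume "s \<ge> t - 1"
  then show "(\<lambda>n. real (ex3 n {F_P t, matching3 (s + 1)}) - real (s * turan_num (n - s) (t - 1)))
    \<in> O(\<lambda>n. real n)"
    using assms(2) by (intro bigo_linearI[of s _ _ "13 * s\<^sup>2 + s"] ex3_turan)
qed

end
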